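(* Let $K$ be a field and let $f(X)\in K[X]$ be an irreducible polynomial of degree $d\ge 3$ over $K$. Then there exists a polynomial $h(X)\in K[X]$ of degree at most $d-1$ such that the composition $f(h(X))$ is reducible over $K$. *)

theory Defs
  imports "HOL-Computational_Algebra.Polynomial"
begin

text \<open>
  Reducible is not the plain negation of irreducible: zero and the units are neither.
  In particular a nonzero constant polynomial over a field is not reducible.
\<close>

definition reducible :: "'a::comm_semiring_1 \<Rightarrow> bool" where
  "reducible p \<longleftrightarrow> p \<noteq> 0 \<and> \<not> p dvd 1 \<and> \<not> irreducible p"

end

theory Submission
  imports Defs
begin

text \<open>
  Let \<alpha> be a root of f. Then \<open>1/\<alpha>\<close> has the reversal \<open>f*\<close> of f as its minimal polynomial, up to a
  constant, and writing \<open>f* = c (1 - X h)\<close> gives \<open>\<alpha> = h(1/\<alpha>)\<close> with h of degree \<open>d - 1\<close>. Thus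
  \<open>1/\<alpha>\<close> is a root of \<open>f(h(X))\<close>, so \<open>f*\<close>, of degree d, divides \<open>f(h(X))\<close>, of degree
  \<open>d (d - 1) > d\<close>.
\<close>

lemma reflect_poly_altdef:
  "reflect_poly f = (\<Sum>i\<le>degree f. monom (coeff f i) (degree f - i))"
proof (rule poly_eqI)
  fix k
  \<comment> \<open>The guard \<open>k \<le> degree f\<close> matters: for larger \<open>k\<close>
    the truncated difference \<open>degree f - k\<close> is 0 and would wrongly select
    \<open>i = 0\<close>.\<close>
  have "coeff (\<Sum>i\<le>degree f. monom (coeff f i) (degree f - i)) k
      = (\<Sum>i\<le>degree f. if i = degree f - k \<and> k \<le> degree f then coeff f i else 0)"
    unfolding coeff_sum by (intro sum.cong) auto
  also have "\<dots> = coeff (reflect_poly f) k"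
    by (cases "k \<le> degree f") (simp_all add: coeff_reflect_poly)
  finally show "coeff (reflect_poly f) k
      = coeff (\<Sum>i\<le>degree f. monom (coeff f i) (degree f - i)) k" ..
qed

lemma pcompose_as_sum:
  fixes f h :: "'a::comm_ring_1 poly"
  shows "pcompose f h = (\<Sum>i\<le>degree f. smult (coeff f i) (h ^ i))"
  by (simp add: pcompose_altdef poly_altdef coeff_map_poly degree_map_poly)

lemma diff_one_dvd_power_diff_one:
  fixes x :: "'a::comm_ring_1"
  shows "x - 1 dvd x ^ n - 1"
  unfolding power_diff_1_eq by (rule dvd_triv_left)

text \<open>Modulo \<open>X h - 1\<close>, the polynomial h is an inverse of X.\<close>

lemma dvd_power_mult_pcompose_minus_reflect_poly:
  fixes f h :: "'a::comm_ring_1 poly"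
  shows "[:0, 1:] * h - 1 dvd [:0, 1:] ^ degree f * pcompose f h - reflect_poly f"
proof -
  let ?X = "[:0, 1:] :: 'a poly"
  \<comment> \<open>Both polynomials are sums over the same coefficients of \<open>f\<close>, so
    they are compared term by term; each difference contains a factor \<open>(X h)^i - 1\<close>,
    which \<open>X h - 1\<close> divides.\<close>
  have "?X ^ degree f * pcompose f h - reflect_poly f
      = (\<Sum>i\<le>degree f. smult (coeff f i) (?X ^ (degree f - i) * ((?X * h) ^ i - 1)))"
    unfolding pcompose_as_sum reflect_poly_altdef sum_distrib_left sum_subtractf [symmetric]
  proof (rule sum.cong)
    fix i assume "i \<in> {..degree f}"
    then have "?X ^ degree f = ?X ^ (degree f - i) * ?X ^ i"
      by (simp flip: power_add)
    then show "?X ^ degree f * smult (coeff f i) (h ^ i) - monom (coeff f i) (degree f - i)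
        = smult (coeff f i) (?X ^ (degree f - i) * ((?X * h) ^ i - 1))"
      by (simp only: monom_altdef power_mult_distrib right_diff_distrib smult_diff_right
          mult_smult_right mult.assoc mult_1_right)
  qed simp
  then show ?thesis
    by (auto intro!: dvd_sum dvd_smult dvd_mult diff_one_dvd_power_diff_one)
qed

text \<open>Since \<open>X\<close> is invertible modulo \<open>X h - 1\<close>, the power of
  \<open>X\<close> in the preceding congruence can be cancelled.\<close>

lemma reflect_poly_dvd_pcompose:
  fixes f h :: "'a::field poly"
  assumes "reflect_poly f = smult c ([:0, 1:] * h - 1)" "c \<noteq> 0"
  shows "reflect_poly f dvd pcompose f h"
proof -
  let ?X = "[:0, 1:] :: 'a poly" and ?p = "[:0, 1:] * h - 1"
  have p: "?p dvd reflect_poly f"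
    by (simp only: assms(1) dvd_smult dvd_refl)
  then have "?p dvd ?X ^ degree f * pcompose f h"
    using dvd_add [OF dvd_power_mult_pcompose_minus_reflect_poly [of h f] p]
    by (simp only: diff_add_cancel)
  \<comment> \<open>Multiplying by \<open>h ^ degree f\<close> turns the power of \<open>X\<close>
    into a power of \<open>X h\<close>, which is 1 modulo \<open>?p\<close>; the subtracted term
    corrects for this exactly.\<close>
  then have "?p dvd h ^ degree f * (?X ^ degree f * pcompose f h)
      - ((?X * h) ^ degree f - 1) * pcompose f h"
    by (rule dvd_diff [OF dvd_mult dvd_mult2 [OF diff_one_dvd_power_diff_one]])
  also have "h ^ degree f * (?X ^ degree f * pcompose f h)
      - ((?X * h) ^ degree f - 1) * pcompose f h = pcompose f h"
    unfolding power_mult_distrib by (simp only: algebra_simps) simp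
  finally show ?thesis
    by (simp only: assms smult_dvd_iff) simp
qed

theorem mainTheorem1:
  fixes f :: "'a::field poly" and d :: nat
  assumes "irreducible f" and "degree f = d" and "d \<ge> 3"
  shows "\<exists>h :: 'a poly. degree h \<le> d - 1 \<and> reducible (pcompose f h)"
proof -
  have "f \<noteq> 0"
    using assms by auto
  \<comment> \<open>Otherwise \<open>X\<close> would be a proper factor of \<open>f\<close>. This
    keeps the degree of the reversal equal to \<open>d\<close>.\<close>
  have "coeff f 0 \<noteq> 0"
  proof
    assume "coeff f 0 = 0"
    then obtain g where g: "f = [:0, 1:] * g"
      by (cases f) auto
    then have "g \<noteq> 0" using \<open>f \<noteq> 0\<close> by auto
    then have "degree f = Suc (degree g)" using g by simp
    moreover have "[:0, 1:] dvd (1::'a poly) \<or> g dvd 1"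
      using irreducibleD [OF assms(1) g] .
    ultimately show False
      using assms(2,3) by (auto simp: is_unit_poly_iff)
  qed
  obtain a q where q: "reflect_poly f = pCons a q"
    by (cases "reflect_poly f")
  have a: "a = lead_coeff f"
    using q by (metis coeff_0_reflect_poly coeff_pCons_0)
  have "a \<noteq> 0" using a \<open>f \<noteq> 0\<close> by simp
  have deg_r: "degree (reflect_poly f) = d"
    using \<open>coeff f 0 \<noteq> 0\<close> assms(2) by simp
  \<comment> \<open>Obtained by solving \<open>a + X q = - a (X h - 1)\<close> for
    \<open>h\<close>.\<close>
  define h where "h = smult (- inverse a) q"
  have "q \<noteq> 0" using deg_r q assms(3) by auto
  then have deg_h: "degree h = d - 1"
    using deg_r q \<open>a \<noteq> 0\<close> by (auto simp: h_def)
  have r: "reflect_poly f = smult (- a) ([:0, 1:] * h - 1)"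
    using \<open>a \<noteq> 0\<close> by (simp add: q h_def smult_diff_right one_pCons)
  have "reflect_poly f dvd pcompose f h"
    using r \<open>a \<noteq> 0\<close> by (intro reflect_poly_dvd_pcompose [of f "- a"]) auto
  then obtain g where g: "pcompose f h = reflect_poly f * g" ..
  have deg: "degree (pcompose f h) = d * (d - 1)"
    using assms(2) deg_h by (simp add: degree_pcompose)
  \<comment> \<open>Here \<open>d \<ge> 3\<close> is essential: for \<open>d = 2\<close> the degrees
    \<open>d (d - 1)\<close> and \<open>d\<close> coincide and the cofactor \<open>g\<close> would
    be constant.\<close>
  have "d * 2 \<le> d * (d - 1)"
    using assms(3) by (intro mult_le_mono) auto
  then have large: "d * (d - 1) > d" using assms(3) by linarith
  have nz: "pcompose f h \<noteq> 0" using deg large by auto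
  then have "g \<noteq> 0" "reflect_poly f \<noteq> 0" using g by auto
  then have "d + degree g = d * (d - 1)"
    using deg deg_r g by (metis degree_mult_eq)
  then have "degree g > 0" using large by linarith
  then have "\<not> irreducible (pcompose f h)"
    using g deg_r assms(3) by (auto dest!: irreducibleD simp: is_unit_poly_iff)
  moreover have "\<not> pcompose f h dvd 1"
    using deg large by (auto simp: is_unit_poly_iff)
  ultimately have "reducible (pcompose f h)"
    using nz by (simp add: reducible_def)
  then show ?thesis
    using deg_h by (intro exI [of _ h]) simp
qed

end
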